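(* Let $p,q\ge 0$ be integers and let $a_1,\dots,a_p,b_1,\dots,b_q$ be arbitrary constants. For every integer $N\ge 0$ put $$F_N(x)={}_{p+N+1}F_{q+N+1}\Bigl(a_1,\dots,a_p,\tfrac{\alpha+1}{\gamma},\tfrac{\alpha+\beta+1}{\gamma},\dots,\tfrac{\alpha+N\beta+1}{\gamma};\,b_1,\dots,b_q,\tfrac{\alpha+\gamma+1}{\gamma},\tfrac{\alpha+\gamma+\beta+1}{\gamma},\dots,\tfrac{\alpha+\gamma+N\beta+1}{\gamma};\,\lambda x^{\gamma}\Bigr).$$ Then, for any constants $\alpha,\beta,\eta,\lambda$ and any nonzero constant $\gamma$, $$\int x^\alpha e^{\eta x^\beta}\,{}_pF_q(a_1,\dots,a_p;b_1,\dots,b_q;\lambda x^{\gamma})\,dx = x^{\alpha+1}e^{\eta x^\beta}\sum_{j=0}^{\infty}\frac{(-\beta\eta x^\beta)^j}{\prod_{m=0}^{j}(\alpha+m\beta+1)}\,F_j(x)+C,$$ where $C$ is an arbitrary constant of integration.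
   Context: Constants are real or complex. The generalized hypergeometric function is defined by the series $${}_pF_q(a_1,\dots,a_p;b_1,\dots,b_q;x)=\sum_{n=0}^{\infty}\frac{(a_1)_n\cdots(a_p)_n}{(b_1)_n\cdots(b_q)_n}\frac{x^n}{n!},$$ with Pochhammer symbol $(\vartheta)_n=\Gamma(\vartheta+n)/\Gamma(\vartheta)$, $(\vartheta)_0=1$. The integral is an indefinite integral (antiderivative) in $x$.
   Formalization: Needs pFq convergent, all α+mβ+1 nonzero, no added lower parameter of F_N in {0,−1,…}, x≠0 with a log branch; if β/γ is negative irrational and some α+mβ+nγ+1 are super-exponentially small (the series can then diverge), local uniform convergence of the j-series is assumed. *)

theory Defs
  imports "HOL-Analysis.Analysis"
begin

(* The term x^n / n! is built into fps_hypergeo: its n-th coefficient is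
   (a_1)_n ... (a_p)_n / ((b_1)_n ... (b_q)_n * n!) when its last argument is 1. *)

definition hypergeom :: "complex list \<Rightarrow> complex list \<Rightarrow> complex \<Rightarrow> complex" where
  "hypergeom as bs z = eval_fps (fps_hypergeo as bs 1) z"

definition hypergeom_converges :: "complex list \<Rightarrow> complex list \<Rightarrow> complex \<Rightarrow> bool" where
  "hypergeom_converges as bs z \<longleftrightarrow> summable (\<lambda>n. fps_nth (fps_hypergeo as bs 1) n * z ^ n)"

(* The power x^a for a branch L of the logarithm. For L = Ln this is x powr a (x \<noteq> 0);
   for an integer a it is the usual power, whatever the branch. *)

definition bpow :: "(complex \<Rightarrow> complex) \<Rightarrow> complex \<Rightarrow> complex \<Rightarrow> complex" where
  "bpow L x a = exp (a * L x)"

definition F_upper ::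
  "complex list \<Rightarrow> complex \<Rightarrow> complex \<Rightarrow> complex \<Rightarrow> nat \<Rightarrow> complex list" where
  "F_upper as \<alpha> \<beta> \<gamma> N = as @ map (\<lambda>m. (\<alpha> + of_nat m * \<beta> + 1) / \<gamma>) [0..<N + 1]"

definition F_lower ::
  "complex list \<Rightarrow> complex \<Rightarrow> complex \<Rightarrow> complex \<Rightarrow> nat \<Rightarrow> complex list" where
  "F_lower bs \<alpha> \<beta> \<gamma> N = bs @ map (\<lambda>m. (\<alpha> + \<gamma> + of_nat m * \<beta> + 1) / \<gamma>) [0..<N + 1]"

definition F_fun :: "(complex \<Rightarrow> complex) \<Rightarrow> complex list \<Rightarrow> complex list \<Rightarrow>
    complex \<Rightarrow> complex \<Rightarrow> complex \<Rightarrow> complex \<Rightarrow> nat \<Rightarrow> complex \<Rightarrow> complex" where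
  "F_fun L as bs \<alpha> \<beta> \<gamma> lam N x =
     hypergeom (F_upper as \<alpha> \<beta> \<gamma> N) (F_lower bs \<alpha> \<beta> \<gamma> N) (lam * bpow L x \<gamma>)"

definition series_term :: "(complex \<Rightarrow> complex) \<Rightarrow> complex list \<Rightarrow> complex list \<Rightarrow> complex \<Rightarrow>
    complex \<Rightarrow> complex \<Rightarrow> complex \<Rightarrow> complex \<Rightarrow> nat \<Rightarrow> complex \<Rightarrow> complex" where
  "series_term L as bs \<alpha> \<beta> \<gamma> \<eta> lam j x =
     (- \<beta> * \<eta> * bpow L x \<beta>) ^ j / (\<Prod>m\<le>j. \<alpha> + of_nat m * \<beta> + 1)
       * F_fun L as bs \<alpha> \<beta> \<gamma> lam j x"

(* Multiplying out, the coefficients of the series have the denominators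
   \<Prod>m\<le>j. \<alpha> + m * \<beta> + n * \<gamma> + 1. Only when \<beta> / \<gamma> is a negative irrational number can
   their factors, though all nonzero, be super-exponentially small; the series over j
   may then diverge. *)

definition small_divisors :: "complex \<Rightarrow> complex \<Rightarrow> complex \<Rightarrow> bool" where
  "small_divisors \<alpha> \<beta> \<gamma> \<longleftrightarrow>
     (\<exists>r::real. r < 0 \<and> r \<notin> \<rat> \<and> \<beta> / \<gamma> = of_real r) \<and>
     (\<forall>\<delta>>0. \<exists>m n. norm (\<alpha> + of_nat m * \<beta> + of_nat n * \<gamma> + 1) < \<delta> ^ (m + n + 1))"

end

theory Submission
  imports Defs "HOL-Complex_Analysis.Complex_Analysis"
begin

text \<open>
Take all powers of \<open>x\<close> along the branch \<open>L\<close>. Write \<open>z = lam * x powr \<gamma>\<close> and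
\<open>v = - \<beta> * \<eta> * x powr \<beta>\<close>, let \<open>c n\<close> be the coefficients of
the hypergeometric series in the integrand, and
\<open>D m n = \<alpha> + m * \<beta> + n * \<gamma> + 1\<close>. The parameters that \<open>F\<^sub>j\<close> adds come in pairs
\<open>A, A + 1\<close>, and the ratio of their Pochhammer symbols is \<open>A / (A + n)\<close>. Hence the \<open>j\<close>-th term
of the series is \<open>v ^ j * p (j + 1)\<close>, where \<open>p j = (\<Sum>n. c n * z ^ n / (\<Prod>m<j. D m n))\<close>
(\<open>fps_hypergeo_F\<close>).

Passing from \<open>p (j + 1)\<close> to \<open>p j\<close> multiplies the coefficients by \<open>D j n\<close>, which is the
first-order differential operator \<open>\<gamma> * z * d/dz + \<alpha> + 1 + j * \<beta>\<close> (\<open>divided_fps_ode\<close>).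
Therefore the derivative of
\<open>x powr (\<alpha> + 1) * exp (\<eta> * x powr \<beta>) * (\<Sum>j<J. v ^ j * p (j + 1))\<close> telescopes to
\<open>x powr \<alpha> * exp (\<eta> * x powr \<beta>) * (p 0 - v ^ J * p J)\<close>, where \<open>p 0\<close> is the
hypergeometric function in the integrand; this is integration by parts repeated \<open>J\<close> times. If the
series converges locally uniformly, Weierstrass' theorem lets \<open>J\<close> tend to infinity and the remainder
vanishes (\<open>divided_series_has_derivative\<close>).

It remains to prove that convergence. Two facts carry it. If \<open>lam\<close> is not 0, then by the maximum
modulus principle \<open>z\<close> never lies on the circle of convergence
(\<open>hypergeom_argument_inside_conv_radius\<close>), so \<open>c n * z ^ n\<close> is absolutely summable, uniformly on
compact sets. And if \<open>\<beta>\<close> is not 0 and there are no small divisors,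
\<open>\<Prod>m\<le>j. norm (D m n)\<close> grows faster than \<open>B ^ j\<close> for every \<open>B\<close>, uniformly in \<open>n\<close>
(\<open>prod_linear_divisor_superexponential\<close>): in each column the divisors are equally spaced, so only
boundedly many are small, at most one is very small, and that one is still at least
\<open>\<epsilon> ^ (j + 1)\<close> for a fixed \<open>\<epsilon> > 0\<close>. If \<open>\<beta> = 0\<close>, the series
reduces to its term for \<open>j = 0\<close>. When there are small divisors, locally uniform convergence is a
hypothesis of the theorem.
\<close>

section \<open>Lower bounds for the divisors\<close>

text \<open>The denominators that appear when the series over \<open>j\<close> and the hypergeometric series in it are multiplied
out. Below, a row is the family of divisors for a fixed \<open>m\<close>, a column that for a fixed \<open>n\<close>.\<close>

definition linear_divisor :: "complex \<Rightarrow> complex \<Rightarrow> complex \<Rightarrow> nat \<Rightarrow> nat \<Rightarrow> complex" where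
  "linear_divisor \<alpha> \<beta> \<gamma> m n = \<alpha> + of_nat m * \<beta> + of_nat n * \<gamma> + 1"

text \<open>The case \<open>n = 0\<close> is excluded by the denominators of the outer series, and a zero with \<open>n > 0\<close>
would make a lower parameter of some \<open>F\<^sub>N\<close> equal to \<open>1 - n\<close>.\<close>

lemma linear_divisor_nonzero:
  assumes "\<gamma> \<noteq> 0"
    and denom: "\<And>m. \<alpha> + of_nat m * \<beta> + 1 \<noteq> 0"
    and lower: "\<And>m. (\<alpha> + \<gamma> + of_nat m * \<beta> + 1) / \<gamma> \<notin> \<int>\<^sub>\<le>\<^sub>0"
  shows "linear_divisor \<alpha> \<beta> \<gamma> m n \<noteq> 0"
proof (cases n)
  case 0
  then show ?thesis using denom[of m] by (simp add: linear_divisor_def)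
next
  case (Suc k)
  show ?thesis
  proof
    assume "linear_divisor \<alpha> \<beta> \<gamma> m n = 0"
    then have "(\<alpha> + \<gamma> + of_nat m * \<beta> + 1) / \<gamma> = - of_nat k"
      using \<open>\<gamma> \<noteq> 0\<close> Suc by (simp add: linear_divisor_def field_simps eq_neg_iff_add_eq_0)
    then show False using lower[of m] by simp
  qed
qed

lemma positive_lower_bound_if_finite_below:
  fixes f :: "'a \<Rightarrow> complex"
  assumes "finite (f ` {x. norm (f x) < r})" and "0 < r" and "\<And>x. f x \<noteq> 0"
  obtains \<delta> where "0 < \<delta>" and "\<delta> \<le> r" and "\<And>x. \<delta> \<le> norm (f x)"
proof
  let ?V = "insert r (norm ` f ` {x. norm (f x) < r})"
  have fin: "finite ?V" using assms(1) by simp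
  show "0 < Min ?V" using fin assms(2,3) by (subst Min_gr_iff) auto
  show "Min ?V \<le> r" using fin by simp
  show "Min ?V \<le> norm (f x)" for x
  proof (cases "norm (f x) < r")
    case True
    then show ?thesis using fin by (intro Min_le) auto
  next
    case False
    then show ?thesis using Min_le[OF fin, of r] by simp
  qed
qed

lemma finite_of_nat_bounded: "finite {n::nat. real n \<le> b}"
proof (rule finite_subset)
  show "{n::nat. real n \<le> b} \<subseteq> {..nat \<lfloor>b\<rfloor>}"
    by (auto simp: le_nat_floor)
qed simp

lemma column_index_bound:
  "real n * norm \<gamma> \<le> norm (linear_divisor \<alpha> \<beta> \<gamma> m n) + norm (\<alpha> + 1) + real m * norm \<beta>"
proof -
  have "of_nat n * \<gamma> = linear_divisor \<alpha> \<beta> \<gamma> m n - (\<alpha> + 1) - of_nat m * \<beta>"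
    by (simp add: linear_divisor_def)
  then have "norm (of_nat n * \<gamma>) \<le> norm (linear_divisor \<alpha> \<beta> \<gamma> m n) + norm (\<alpha> + 1) + norm (of_nat m * \<beta>)"
    by (metis (no_types, lifting) add_mono_thms_linordered_semiring(3) norm_triangle_ineq4 order_trans)
  then show ?thesis by (simp add: norm_mult)
qed

text \<open>For a fixed \<open>m\<close> the divisors tend to infinity with \<open>n\<close>, so only finitely many are below 1.
This is what keeps the radius of convergence when a power series is divided by one more row.\<close>

lemma linear_divisor_row_lower_bound:
  assumes "\<gamma> \<noteq> 0" and nz: "\<And>n. linear_divisor \<alpha> \<beta> \<gamma> m n \<noteq> 0"
  obtains \<delta> where "0 < \<delta>" and "\<And>n. \<delta> \<le> norm (linear_divisor \<alpha> \<beta> \<gamma> m n)"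
proof -
  have "finite {n. norm (linear_divisor \<alpha> \<beta> \<gamma> m n) < 1}"
  proof (rule finite_subset[OF _ finite_of_nat_bounded])
    show "{n. norm (linear_divisor \<alpha> \<beta> \<gamma> m n) < 1}
        \<subseteq> {n. real n \<le> (1 + norm (\<alpha> + 1) + real m * norm \<beta>) / norm \<gamma>}"
    proof safe
      fix n assume "norm (linear_divisor \<alpha> \<beta> \<gamma> m n) < 1"
      then have "real n * norm \<gamma> \<le> 1 + norm (\<alpha> + 1) + real m * norm \<beta>"
        using column_index_bound[of n \<gamma> \<alpha> \<beta> m] by linarith
      then show "real n \<le> (1 + norm (\<alpha> + 1) + real m * norm \<beta>) / norm \<gamma>"
        using \<open>\<gamma> \<noteq> 0\<close> by (simp add: field_simps)
    qed
  qed
  then show thesis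
    using positive_lower_bound_if_finite_below[of "linear_divisor \<alpha> \<beta> \<gamma> m" 1] nz that
    by (metis finite_imageI zero_less_one)
qed

text \<open>Divided by \<open>\<gamma>\<close>, the divisors are \<open>a + m * \<tau> + n\<close> with \<open>\<tau> = \<beta> / \<gamma>\<close>, and only
finitely many values have norm below 1. If \<open>\<tau>\<close> is not real, the imaginary part bounds \<open>m\<close> and
then the real part bounds \<open>n\<close>; if \<open>\<tau>\<close> is real and positive, there is no cancellation in
\<open>m * \<tau> + n\<close>. If \<open>\<tau>\<close> is rational, infinitely many index pairs may be involved, but their
values lie in a translate of a discrete group.\<close>

lemma linear_divisor_uniform_lower_bound:
  assumes "\<gamma> \<noteq> 0" and nz: "\<And>m n. linear_divisor \<alpha> \<beta> \<gamma> m n \<noteq> 0"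
    and ratio: "\<nexists>r::real. r < 0 \<and> r \<notin> \<rat> \<and> \<beta> / \<gamma> = of_real r"
  obtains \<delta> where "0 < \<delta>" and "\<delta> \<le> 1" and "\<And>m n. \<delta> \<le> norm (linear_divisor \<alpha> \<beta> \<gamma> m n)"
proof -
  define a where "a = (\<alpha> + 1) / \<gamma>"
  define \<tau> where "\<tau> = \<beta> / \<gamma>"
  define D where "D = (\<lambda>(m, n). linear_divisor \<alpha> \<beta> \<gamma> m n)"
  define r where "r = 1 / norm \<gamma> + norm a"
  have D: "D (m, n) = \<gamma> * (a + of_nat m * \<tau> + of_nat n)" for m n
    using \<open>\<gamma> \<noteq> 0\<close> by (simp add: D_def linear_divisor_def a_def \<tau>_def field_simps)
  have small: "norm (of_nat m * \<tau> + of_nat n) \<le> r" if "norm (D (m, n)) < 1" for m n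
  proof -
    have "norm (a + of_nat m * \<tau> + of_nat n) \<le> 1 / norm \<gamma>"
    proof -
      have "norm \<gamma> * norm (a + of_nat m * \<tau> + of_nat n) < 1"
        using that by (simp only: D norm_mult)
      then show ?thesis using \<open>\<gamma> \<noteq> 0\<close> by (simp add: pos_le_divide_eq mult.commute)
    qed
    moreover have "norm (of_nat m * \<tau> + of_nat n) \<le> norm (a + of_nat m * \<tau> + of_nat n) + norm a"
      using norm_triangle_ineq4[of "a + of_nat m * \<tau> + of_nat n" a] by (simp add: algebra_simps)
    ultimately show ?thesis by (simp add: r_def)
  qed
  have "finite (D ` {x. norm (D x) < 1})"
  proof (cases "\<tau> \<in> \<real>")
    case False
    then have im: "Im \<tau> \<noteq> 0" by (simp add: complex_is_Real_iff)
    have "{x. norm (D x) < 1}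
        \<subseteq> {m. real m \<le> r / \<bar>Im \<tau>\<bar>} \<times> {n. real n \<le> r + r / \<bar>Im \<tau>\<bar> * \<bar>Re \<tau>\<bar>}"
    proof safe
      fix m n assume "norm (D (m, n)) < 1"
      note s = small[OF this]
      have "\<bar>real m * Im \<tau>\<bar> \<le> r"
        using abs_Im_le_cmod[of "of_nat m * \<tau> + of_nat n"] s by simp
      then show m: "real m \<le> r / \<bar>Im \<tau>\<bar>"
        using im by (simp add: abs_mult field_simps)
      have "\<bar>real m * Re \<tau> + real n\<bar> \<le> r"
        using abs_Re_le_cmod[of "of_nat m * \<tau> + of_nat n"] s by simp
      then have "real n \<le> r + real m * \<bar>Re \<tau>\<bar>"
        using abs_mult[of "real m" "Re \<tau>"] by linarith
      then show "real n \<le> r + r / \<bar>Im \<tau>\<bar> * \<bar>Re \<tau>\<bar>"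
        using mult_right_mono[OF m, of "\<bar>Re \<tau>\<bar>"] by simp
    qed
    then show ?thesis
      by (intro finite_imageI) (rule finite_subset, auto intro: finite_of_nat_bounded)
  next
    case True
    then obtain t where t: "\<tau> = of_real t" by (auto elim: Reals_cases)
    have t_small: "\<bar>real m * t + real n\<bar> \<le> r" if "norm (D (m, n)) < 1" for m n
    proof -
      have "of_nat m * \<tau> + of_nat n = of_real (real m * t + real n)" by (simp add: t)
      then show ?thesis using small[OF that] by (metis norm_of_real)
    qed
    show ?thesis
    proof (cases "t \<in> \<rat>")
      case True
      then obtain p q :: int where q: "q > 0" and pq: "t = of_int p / of_int q"
        by (auto elim!: Rats_cases')
      have "D ` {x. norm (D x) < 1}
          \<subseteq> (\<lambda>k. \<gamma> * (a + of_int k / of_int q)) ` {k. \<bar>of_int k\<bar> \<le> r * of_int q}"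
      proof safe
        fix m n assume "norm (D (m, n)) < 1"
        note s = t_small[OF this]
        define k where "k = int m * p + int n * q"
        \<comment> \<open>The value of the divisor depends on the index pair through \<open>k\<close> only.\<close>
        have k: "real m * t + real n = of_int k / of_int q"
          using q by (simp add: k_def pq field_simps)
        have "of_nat m * \<tau> + of_nat n = of_int k / of_int q"
          using q by (simp add: k_def pq t field_simps)
        then have "D (m, n) = \<gamma> * (a + of_int k / of_int q)"
          by (simp add: D add.assoc)
        moreover have "\<bar>of_int k\<bar> \<le> r * of_int q"
          using s q unfolding k by (simp add: abs_divide field_simps)
        ultimately show "D (m, n) \<in> (\<lambda>k. \<gamma> * (a + of_int k / of_int q)) ` {k. \<bar>of_int k\<bar> \<le> r * of_int q}"
          by blast
      qed
      moreover have "{k::int. \<bar>real_of_int k\<bar> \<le> r * of_int q} \<subseteq> {- \<lceil>r * of_int q\<rceil>..\<lceil>r * of_int q\<rceil>}"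
        by (auto; linarith)
      then have "finite {k::int. \<bar>real_of_int k\<bar> \<le> r * of_int q}"
        by (rule finite_subset) simp
      ultimately show ?thesis by (meson finite_imageI finite_subset)
    next
      case False
      then have "t > 0"
        using ratio t by (metis \<tau>_def Rats_0 linorder_neqE_linordered_idom)
      have "{x. norm (D x) < 1} \<subseteq> {m. real m \<le> r / t} \<times> {n. real n \<le> r}"
      proof safe
        fix m n assume "norm (D (m, n)) < 1"
        note s = t_small[OF this]
        have "real m * t \<ge> 0" using \<open>t > 0\<close> by simp
        then have "real m * t \<le> r" "real n \<le> r" using s by linarith+
        then show "real m \<le> r / t" "real n \<le> r" using \<open>t > 0\<close> by (simp_all add: field_simps)
      qed
      then show ?thesis
        by (intro finite_imageI) (rule finite_subset, auto intro: finite_of_nat_bounded)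
    qed
  qed
  then obtain \<delta> where "0 < \<delta>" "\<delta> \<le> 1" "\<And>x. \<delta> \<le> norm (D x)"
    using positive_lower_bound_if_finite_below[of D 1] nz by (auto simp: D_def)
  then show thesis using that by (force simp: D_def)
qed

text \<open>The form in which the absence of small divisors is used: a uniform positive lower bound is also an
exponential one, so the two ways of not having small divisors need not be distinguished later.\<close>

lemma linear_divisor_exponential_lower_bound:
  assumes "\<gamma> \<noteq> 0" and nz: "\<And>m n. linear_divisor \<alpha> \<beta> \<gamma> m n \<noteq> 0"
    and "\<not> small_divisors \<alpha> \<beta> \<gamma>"
  obtains \<delta> where "0 < \<delta>" and "\<delta> \<le> 1"
    and "\<And>m n. \<delta> ^ (m + n + 1) \<le> norm (linear_divisor \<alpha> \<beta> \<gamma> m n)"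
proof (cases "\<exists>r::real. r < 0 \<and> r \<notin> \<rat> \<and> \<beta> / \<gamma> = of_real r")
  case True
  then obtain \<delta> where \<delta>: "\<delta> > 0" "\<And>m n. \<delta> ^ (m + n + 1) \<le> norm (linear_divisor \<alpha> \<beta> \<gamma> m n)"
    using assms(3) unfolding small_divisors_def linear_divisor_def by (meson not_less)
  show thesis
  proof
    show "0 < min \<delta> 1" "min \<delta> 1 \<le> 1" using \<delta>(1) by auto
    show "min \<delta> 1 ^ (m + n + 1) \<le> norm (linear_divisor \<alpha> \<beta> \<gamma> m n)" for m n
      using \<delta> by (intro order_trans[OF power_mono \<delta>(2)]) auto
  qed
next
  case False
  obtain \<delta> where \<delta>: "0 < \<delta>" "\<delta> \<le> 1" "\<And>m n. \<delta> \<le> norm (linear_divisor \<alpha> \<beta> \<gamma> m n)"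
    using linear_divisor_uniform_lower_bound[OF assms(1,2) False] by blast
  show thesis
  proof
    show "\<delta> ^ (m + n + 1) \<le> norm (linear_divisor \<alpha> \<beta> \<gamma> m n)" for m n
      using \<delta> power_le_one[of \<delta> "m + n"] mult_left_le[of "\<delta> ^ (m + n)" \<delta>]
      by (auto intro: order_trans[OF _ \<delta>(3)])
  qed (use \<delta> in auto)
qed

section \<open>Growth of products of divisors\<close>

text \<open>Consecutive points of the progression are at distance \<open>norm \<beta>\<close>, and two points of the ball are
at distance less than \<open>2 * R\<close>.\<close>

lemma arithmetic_progression_in_ball:
  fixes u \<beta> :: complex
  assumes "\<beta> \<noteq> 0" and "2 * R \<le> real K * norm \<beta>"
  obtains m0 where "{m. norm (u + of_nat m * \<beta>) < R} \<subseteq> {m0..<m0 + K}"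
proof
  let ?A = "{m. norm (u + of_nat m * \<beta>) < R}"
  define m0 where "m0 = (LEAST m. m \<in> ?A)"
  show "?A \<subseteq> {m0..<m0 + K}"
  proof
    fix m assume m: "m \<in> ?A"
    have m0: "m0 \<in> ?A" unfolding m0_def using m by (rule LeastI)
    have le: "m0 \<le> m" unfolding m0_def using m by (rule Least_le)
    have "norm ((u + of_nat m * \<beta>) - (u + of_nat m0 * \<beta>)) < 2 * R"
      using m m0 norm_triangle_ineq4[of "u + of_nat m * \<beta>" "u + of_nat m0 * \<beta>"] by simp
    also have "(u + of_nat m * \<beta>) - (u + of_nat m0 * \<beta>) = of_nat (m - m0) * \<beta>"
      using le by (simp add: of_nat_diff algebra_simps)
    finally have "real (m - m0) * norm \<beta> < real K * norm \<beta>"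
      using assms(2) by (simp add: norm_mult)
    then have "m - m0 < K" using assms(1) by (simp add: mult_less_cancel_right)
    then show "m \<in> {m0..<m0 + K}" using le by auto
  qed
qed

text \<open>The first \<open>j + 1\<close> factors split into those of size at least \<open>R\<close>, at most \<open>K\<close> that lie between
\<open>\<kappa>\<close> and \<open>R\<close>, and at most one below \<open>\<kappa>\<close>, which is bounded below by \<open>\<epsilon>\<close>. Only the last
one can be tiny, so the product loses little against \<open>R ^ Suc j\<close>.\<close>

lemma prod_lower_bound_few_small_factors:
  fixes f :: "nat \<Rightarrow> real"
  assumes R: "1 \<le> R" and \<kappa>: "0 < \<kappa>" "\<kappa> \<le> 1" and \<epsilon>: "0 < \<epsilon>" "\<epsilon> \<le> 1"
    and bad: "{m. f m < R} \<subseteq> {m0..<m0 + K}"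
    and tiny: "{m. f m < \<kappa>} \<subseteq> {m1..<m1 + 1}"
    and \<epsilon>_le: "\<And>m. m \<le> j \<Longrightarrow> f m < \<kappa> \<Longrightarrow> \<epsilon> \<le> f m"
  shows "R ^ Suc j * \<kappa> ^ K * \<epsilon> \<le> R ^ K * (\<Prod>m\<le>j. f m)"
proof -
  define good where "good = {m \<in> {..j}. R \<le> f m}"
  define mid where "mid = {m \<in> {..j}. f m < R \<and> \<kappa> \<le> f m}"
  define small where "small = {m \<in> {..j}. f m < R \<and> f m < \<kappa>}"
  have fin: "finite good" "finite mid" "finite small"
    by (auto simp: good_def mid_def small_def)
  have split: "{..j} = good \<union> (mid \<union> small)"
    by (auto simp: good_def mid_def small_def)
  have prod: "(\<Prod>m\<le>j. f m) = prod f good * (prod f mid * prod f small)"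
    unfolding split using fin
    by (subst prod.union_disjoint; (subst prod.union_disjoint)?)
       (auto simp: good_def mid_def small_def)
  have K: "card (mid \<union> small) \<le> K"
    using card_mono[of "{m0..<m0 + K}" "mid \<union> small"] bad
    by (auto simp: mid_def small_def)
  have "Suc j = card {..j}" by simp
  also have "\<dots> \<le> card good + card (mid \<union> small)"
    unfolding split by (rule card_Un_le)
  finally have "Suc j \<le> card good + K" using K by simp
  then have "R ^ Suc j \<le> R ^ K * R ^ card good"
    using power_increasing[of "Suc j" "card good + K" R] R
    by (simp add: power_add mult.commute del: power_Suc)
  also have "R ^ card good \<le> prod f good"
    using prod_mono[of good "\<lambda>_. R" f] R by (auto simp: good_def)
  finally have g: "R ^ Suc j \<le> R ^ K * prod f good" using R by simp
  have "card mid \<le> K"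
    using K card_mono[of "mid \<union> small" mid] fin by simp
  then have "\<kappa> ^ K \<le> \<kappa> ^ card mid"
    using power_decreasing[of "card mid" K \<kappa>] \<kappa> by simp
  also have "\<dots> \<le> prod f mid"
    using prod_mono[of mid "\<lambda>_. \<kappa>" f] \<kappa> by (auto simp: mid_def)
  finally have m: "\<kappa> ^ K \<le> prod f mid" .
  have "small \<subseteq> {m1}" using tiny by (auto simp: small_def)
  then consider "small = {}" | "small = {m1}" by blast
  then have s: "\<epsilon> \<le> prod f small"
  proof cases
    case 1
    then show ?thesis using \<epsilon> by simp
  next
    case 2
    then have "m1 \<le> j \<and> f m1 < \<kappa>" by (auto simp: small_def)
    then show ?thesis unfolding 2 using \<epsilon>_le by simp
  qed
  have "R ^ Suc j * (\<kappa> ^ K * \<epsilon>) \<le> (R ^ K * prod f good) * (prod f mid * prod f small)"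
    using g m s R \<kappa> \<epsilon> by (intro mult_mono) (auto intro!: mult_nonneg_nonneg prod_nonneg simp: good_def mid_def)
  then show ?thesis by (simp add: prod mult_ac)
qed

text \<open>The quantitative heart of the convergence proof: the bound holds uniformly in \<open>n\<close>. In column \<open>n\<close>
the divisors form a progression of step \<open>\<beta>\<close>, so all but \<open>K\<close> of them exceed any prescribed \<open>R\<close>, and at
most one is smaller than \<open>norm \<beta> / 2\<close>. A small divisor with \<open>m \<le> j\<close> forces
\<open>n = O(j + 1)\<close>, so it is at least \<open>\<epsilon> ^ Suc j\<close> for an \<open>\<epsilon>\<close> that does not depend on
\<open>n\<close> or \<open>R\<close>. Choosing \<open>R\<close> as large as \<open>max 1 B / \<epsilon>\<close> compensates for it.

If \<open>\<beta> = 0\<close>, the columns are constant and the bound fails in general for \<open>B > 0\<close>; in the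
application \<open>B\<close> bounds a multiple of \<open>\<beta>\<close>.\<close>

lemma prod_linear_divisor_superexponential:
  assumes "\<gamma> \<noteq> 0" and nz: "\<And>m n. linear_divisor \<alpha> \<beta> \<gamma> m n \<noteq> 0"
    and small: "\<not> small_divisors \<alpha> \<beta> \<gamma>"
    and B: "0 \<le> B" "\<beta> = 0 \<Longrightarrow> B = 0"
  obtains C where "0 \<le> C" and "\<And>j n. B ^ j \<le> C * (\<Prod>m\<le>j. norm (linear_divisor \<alpha> \<beta> \<gamma> m n))"
proof (cases "\<beta> = 0")
  case True
  then have "B = 0" by (rule B(2))
  obtain \<delta> where \<delta>: "0 < \<delta>" "\<And>n. \<delta> \<le> norm (linear_divisor \<alpha> \<beta> \<gamma> 0 n)"
    using linear_divisor_row_lower_bound[OF assms(1), of \<alpha> \<beta> 0] nz by metis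
  show thesis
  proof
    show "0 \<le> 1 / \<delta>" using \<delta> by simp
    show "B ^ j \<le> 1 / \<delta> * (\<Prod>m\<le>j. norm (linear_divisor \<alpha> \<beta> \<gamma> m n))" for j n
    proof (cases j)
      case 0
      then show ?thesis using \<delta> by (simp add: field_simps)
    next
      case (Suc k)
      then show ?thesis using \<open>B = 0\<close> \<delta> by (simp add: prod_nonneg)
    qed
  qed
next
  case False
  obtain \<delta> where \<delta>: "0 < \<delta>" "\<delta> \<le> 1"
      "\<And>m n. \<delta> ^ (m + n + 1) \<le> norm (linear_divisor \<alpha> \<beta> \<gamma> m n)"
    using linear_divisor_exponential_lower_bound[OF assms(1-3)] by blast
  define \<kappa> where "\<kappa> = min 1 (norm \<beta> / 2)"
  have \<kappa>: "0 < \<kappa>" "\<kappa> \<le> 1" "2 * \<kappa> \<le> real 1 * norm \<beta>"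
    using False by (auto simp: \<kappa>_def)
  \<comment> \<open>If a divisor with \<open>m \<le> j\<close> is below \<open>\<kappa>\<close>, then \<open>n \<le> Suc j * c\<close>,
    hence \<open>m + n + 1 \<le> Suc c * Suc j\<close>.\<close>
  define c where "c = nat \<lceil>(\<kappa> + norm (\<alpha> + 1) + norm \<beta>) / norm \<gamma>\<rceil>"
  have c: "\<kappa> + norm (\<alpha> + 1) + norm \<beta> \<le> real c * norm \<gamma>"
  proof -
    have "(\<kappa> + norm (\<alpha> + 1) + norm \<beta>) / norm \<gamma> \<le> real c"
      unfolding c_def by (rule real_nat_ceiling_ge)
    then show ?thesis using assms(1) by (simp add: field_simps)
  qed
  define \<epsilon> where "\<epsilon> = \<delta> ^ Suc c"
  have \<epsilon>: "0 < \<epsilon>" "\<epsilon> \<le> 1"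
    using \<delta>(1,2) unfolding \<epsilon>_def by (auto intro: power_le_one simp del: power_Suc)
  define R where "R = max 1 B / \<epsilon>"
  have R: "1 \<le> R" using \<epsilon> by (simp add: R_def field_simps)
  define K where "K = nat \<lceil>2 * R / norm \<beta>\<rceil>"
  have K: "2 * R \<le> real K * norm \<beta>"
  proof -
    have "2 * R / norm \<beta> \<le> real K" unfolding K_def by (rule real_nat_ceiling_ge)
    then show ?thesis using False by (simp add: field_simps)
  qed
  show thesis
  proof
    show "0 \<le> R ^ K / \<kappa> ^ K" using R \<kappa> by simp
    show "B ^ j \<le> R ^ K / \<kappa> ^ K * (\<Prod>m\<le>j. norm (linear_divisor \<alpha> \<beta> \<gamma> m n))" for j n
    proof -
      define f where "f m = norm (linear_divisor \<alpha> \<beta> \<gamma> m n)" for m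
      have f: "f m = norm ((\<alpha> + 1 + of_nat n * \<gamma>) + of_nat m * \<beta>)" for m
        by (simp add: f_def linear_divisor_def algebra_simps)
      obtain m0 where m0: "{m. f m < R} \<subseteq> {m0..<m0 + K}"
        using arithmetic_progression_in_ball[OF False K] unfolding f by blast
      obtain m1 where m1: "{m. f m < \<kappa>} \<subseteq> {m1..<m1 + 1}"
        using arithmetic_progression_in_ball[OF False \<kappa>(3)] unfolding f by blast
      have tiny: "\<epsilon> ^ Suc j \<le> f m" if "m \<le> j" "f m < \<kappa>" for m
      proof -
        have "real n * norm \<gamma> \<le> \<kappa> + norm (\<alpha> + 1) + real m * norm \<beta>"
          using column_index_bound[of n \<gamma> \<alpha> \<beta> m] that(2) by (simp add: f_def)
        also have "\<dots> \<le> real (Suc j) * (\<kappa> + norm (\<alpha> + 1) + norm \<beta>)"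
        proof -
          have "real m * norm \<beta> \<le> real (Suc j) * norm \<beta>"
            using that(1) by (intro mult_right_mono) auto
          moreover have "\<kappa> + norm (\<alpha> + 1) \<le> real (Suc j) * (\<kappa> + norm (\<alpha> + 1))"
            using \<kappa> mult_right_mono[of 1 "real (Suc j)" "\<kappa> + norm (\<alpha> + 1)"] by simp
          ultimately show ?thesis by (simp only: distrib_left)
        qed
        also have "\<dots> \<le> real (Suc j) * (real c * norm \<gamma>)"
          using c by (intro mult_left_mono) auto
        finally have "real n * norm \<gamma> \<le> real (Suc j * c) * norm \<gamma>"
          by (simp only: of_nat_mult mult.assoc)
        then have "n \<le> Suc j * c"
          using assms(1) by (simp only: mult_le_cancel_right of_nat_le_iff) simp
        then have "m + n + 1 \<le> Suc c * Suc j" using that(1) by (simp add: mult.commute)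
        then have "\<delta> ^ (Suc c * Suc j) \<le> \<delta> ^ (m + n + 1)"
          using \<delta> by (intro power_decreasing) auto
        also have "\<dots> \<le> f m" unfolding f_def by (rule \<delta>(3))
        finally show ?thesis by (simp only: \<epsilon>_def power_mult)
      qed
      have "R ^ Suc j * \<kappa> ^ K * \<epsilon> ^ Suc j \<le> R ^ K * (\<Prod>m\<le>j. f m)"
        using \<epsilon> by (intro prod_lower_bound_few_small_factors[OF R \<kappa>(1,2) _ _ m0 m1 tiny]) (auto intro: power_le_one simp del: power_Suc)
      moreover have "B ^ j \<le> R ^ Suc j * \<epsilon> ^ Suc j"
      proof -
        have "B ^ j \<le> max 1 B ^ j" using B by (intro power_mono) auto
        also have "\<dots> \<le> max 1 B ^ Suc j" by (intro power_increasing) auto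
        also have "\<dots> = R ^ Suc j * \<epsilon> ^ Suc j"
          using \<epsilon> by (simp add: R_def power_mult_distrib[symmetric] del: power_Suc)
        finally show ?thesis .
      qed
      ultimately have "B ^ j * \<kappa> ^ K \<le> R ^ K * (\<Prod>m\<le>j. f m)"
        using \<kappa>(1) by (elim order_trans[rotated]) (simp add: mult_ac mult_left_mono del: power_Suc)
      then show ?thesis using \<kappa> by (simp add: f_def field_simps)
    qed
  qed
qed

section \<open>Power series divided by products of divisors\<close>

text \<open>For the coefficients \<open>c\<close> of a hypergeometric series, this is \<open>F\<^sub>N\<close> with \<open>N = j - 1\<close>, up to the
factor \<open>\<Prod>m<j. \<alpha> + m * \<beta> + 1\<close> that the outer series divides out; \<open>j = 0\<close> gives back the
integrand's series, which makes the recurrence below uniform in \<open>j\<close>.\<close>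

definition divided_fps :: "complex fps \<Rightarrow> complex \<Rightarrow> complex \<Rightarrow> complex \<Rightarrow> nat \<Rightarrow> complex fps" where
  "divided_fps c \<alpha> \<beta> \<gamma> j =
     Abs_fps (\<lambda>n. fps_nth c n / (\<Prod>m<j. linear_divisor \<alpha> \<beta> \<gamma> m n))"

lemma divided_fps_0 [simp]: "divided_fps c \<alpha> \<beta> \<gamma> 0 = c"
  by (simp add: divided_fps_def fps_eq_iff)

lemma fps_conv_radius_mono_coeff:
  fixes f g :: "complex fps"
  assumes "\<And>n. norm (fps_nth g n) \<le> C * norm (fps_nth f n)"
  shows "fps_conv_radius f \<le> fps_conv_radius g"
  unfolding fps_conv_radius_def
proof (rule conv_radius_geI_ex)
  fix r :: real assume r: "0 < r" "ereal r < conv_radius (fps_nth f)"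
  have "summable (\<lambda>n. C * norm (fps_nth f n * of_real r ^ n))"
    using r by (intro summable_mult abs_summable_in_conv_radius) simp
  then have "summable (\<lambda>n. fps_nth g n * of_real r ^ n)"
  proof (rule summable_comparison_test'[where N = 0])
    show "norm (fps_nth g n * of_real r ^ n) \<le> C * norm (fps_nth f n * of_real r ^ n)" for n
      using mult_right_mono[OF assms, of "r ^ n" n] r by (simp add: norm_mult norm_power mult_ac)
  qed
  then show "\<exists>z::complex. norm z = r \<and> summable (\<lambda>n. fps_nth g n * z ^ n)"
    using r by (intro exI[of _ "of_real r"]) auto
qed

lemma divided_fps_conv_radius:
  assumes "\<gamma> \<noteq> 0" and nz: "\<And>m n. linear_divisor \<alpha> \<beta> \<gamma> m n \<noteq> 0"
  shows "fps_conv_radius c \<le> fps_conv_radius (divided_fps c \<alpha> \<beta> \<gamma> j)"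
proof (induction j)
  case 0
  show ?case by simp
next
  case (Suc j)
  obtain \<delta> where \<delta>: "0 < \<delta>" "\<And>n. \<delta> \<le> norm (linear_divisor \<alpha> \<beta> \<gamma> j n)"
    using linear_divisor_row_lower_bound[OF assms(1), of \<alpha> \<beta> j] nz by metis
  have "norm (fps_nth (divided_fps c \<alpha> \<beta> \<gamma> (Suc j)) n)
      \<le> (1 / \<delta>) * norm (fps_nth (divided_fps c \<alpha> \<beta> \<gamma> j) n)" for n
  proof -
    have "fps_nth (divided_fps c \<alpha> \<beta> \<gamma> (Suc j)) n
        = fps_nth (divided_fps c \<alpha> \<beta> \<gamma> j) n / linear_divisor \<alpha> \<beta> \<gamma> j n"
      by (simp add: divided_fps_def)
    then show ?thesis
      using \<delta>(1) \<delta>(2)[of n] by (simp add: norm_divide frac_le)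
  qed
  from fps_conv_radius_mono_coeff[OF this] Suc show ?case by (rule order_trans[rotated])
qed

text \<open>The coefficient of \<open>z ^ n\<close> is multiplied by the divisor
\<open>(\<alpha> + 1 + j * \<beta>) + n * \<gamma>\<close> on passing from \<open>j + 1\<close> back to \<open>j\<close>, and multiplication by
\<open>n\<close> is the Euler operator \<open>z * d/dz\<close>.\<close>

lemma divided_fps_ode:
  assumes nz: "\<And>m n. linear_divisor \<alpha> \<beta> \<gamma> m n \<noteq> 0"
  shows "divided_fps c \<alpha> \<beta> \<gamma> j =
     fps_const \<gamma> * (fps_X * fps_deriv (divided_fps c \<alpha> \<beta> \<gamma> (Suc j)))
     + fps_const (\<alpha> + 1 + of_nat j * \<beta>) * divided_fps c \<alpha> \<beta> \<gamma> (Suc j)"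
proof (rule fps_ext)
  fix n
  let ?p = "divided_fps c \<alpha> \<beta> \<gamma> (Suc j)"
  have "fps_nth (divided_fps c \<alpha> \<beta> \<gamma> j) n = linear_divisor \<alpha> \<beta> \<gamma> j n * fps_nth ?p n"
    using nz by (simp add: divided_fps_def)
  also have "\<dots> = \<gamma> * (of_nat n * fps_nth ?p n) + (\<alpha> + 1 + of_nat j * \<beta>) * fps_nth ?p n"
    by (simp add: linear_divisor_def algebra_simps)
  also have "of_nat n * fps_nth ?p n = fps_nth (fps_X * fps_deriv ?p) n"
    by (cases n) simp_all
  finally show "fps_nth (divided_fps c \<alpha> \<beta> \<gamma> j) n = fps_nth (fps_const \<gamma> * (fps_X * fps_deriv ?p)
     + fps_const (\<alpha> + 1 + of_nat j * \<beta>) * ?p) n"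
    by simp
qed

lemma eval_divided_fps_ode:
  assumes "\<gamma> \<noteq> 0" and nz: "\<And>m n. linear_divisor \<alpha> \<beta> \<gamma> m n \<noteq> 0"
    and z: "norm z < fps_conv_radius c"
  shows "\<gamma> * z * eval_fps (fps_deriv (divided_fps c \<alpha> \<beta> \<gamma> (Suc j))) z =
     eval_fps (divided_fps c \<alpha> \<beta> \<gamma> j) z
     - (\<alpha> + 1 + of_nat j * \<beta>) * eval_fps (divided_fps c \<alpha> \<beta> \<gamma> (Suc j)) z"
proof -
  let ?p = "divided_fps c \<alpha> \<beta> \<gamma> (Suc j)"
  have p: "norm z < fps_conv_radius ?p"
    using z divided_fps_conv_radius[OF assms(1,2), of c "Suc j"] by (rule less_le_trans)
  then have p': "norm z < fps_conv_radius (fps_deriv ?p)"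
    using fps_conv_radius_deriv less_le_trans by blast
  have X: "norm z < fps_conv_radius (fps_X * fps_deriv ?p)"
    using p' by (intro less_le_trans[OF _ fps_conv_radius_mult]) simp
  have "norm z < fps_conv_radius (fps_const \<gamma> * (fps_X * fps_deriv ?p))"
       "norm z < fps_conv_radius (fps_const (\<alpha> + 1 + of_nat j * \<beta>) * ?p)"
    using X p by (auto intro!: less_le_trans[OF _ fps_conv_radius_mult] simp del: of_nat_Suc)
  then have "eval_fps (divided_fps c \<alpha> \<beta> \<gamma> j) z
      = \<gamma> * (z * eval_fps (fps_deriv ?p) z) + (\<alpha> + 1 + of_nat j * \<beta>) * eval_fps ?p z"
    using p p' X by (subst divided_fps_ode[OF nz]) (simp add: eval_fps_add eval_fps_mult)
  then show ?thesis by simp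
qed

text \<open>The factor \<open>(1 / 2) ^ j\<close> comes from applying the lower bound for the divisors with \<open>2 * B\<close> in place
of \<open>B\<close>; its uniformity in \<open>n\<close> leaves the convergent majorant
\<open>\<Sum>n. norm (fps_nth c n) * \<rho> ^ n\<close> for the inner sum.\<close>

lemma divided_fps_terms_bound:
  assumes "\<gamma> \<noteq> 0" and nz: "\<And>m n. linear_divisor \<alpha> \<beta> \<gamma> m n \<noteq> 0"
    and small: "\<not> small_divisors \<alpha> \<beta> \<gamma>"
    and B: "0 \<le> B" "\<beta> = 0 \<Longrightarrow> B = 0"
    and \<rho>: "0 \<le> \<rho>" "ereal \<rho> < fps_conv_radius c"
  obtains M where "\<And>j v z. norm v \<le> B \<Longrightarrow> norm z \<le> \<rho> \<Longrightarrow>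
      norm (v ^ j * eval_fps (divided_fps c \<alpha> \<beta> \<gamma> (Suc j)) z) \<le> M * (1 / 2) ^ j"
proof -
  obtain C where C: "0 \<le> C"
      "\<And>j n. (2 * B) ^ j \<le> C * (\<Prod>m\<le>j. norm (linear_divisor \<alpha> \<beta> \<gamma> m n))"
    using prod_linear_divisor_superexponential[OF assms(1-3), of "2 * B"] B by auto
  have sum: "summable (\<lambda>n. norm (fps_nth c n) * \<rho> ^ n)"
    using norm_summable_fps[of "of_real \<rho>" c] \<rho> by (simp add: norm_mult norm_power)
  show thesis
  proof
    fix j and v z :: complex assume v: "norm v \<le> B" and z: "norm z \<le> \<rho>"
    let ?p = "divided_fps c \<alpha> \<beta> \<gamma> (Suc j)"
    have coeff: "norm (v ^ j * (fps_nth ?p n * z ^ n)) \<le> C * (1 / 2) ^ j * (norm (fps_nth c n) * \<rho> ^ n)"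
      for n
    proof -
      let ?P = "\<Prod>m\<le>j. norm (linear_divisor \<alpha> \<beta> \<gamma> m n)"
      have P: "0 < ?P" using nz by (intro prod_pos) simp
      have "norm v ^ j / ?P \<le> B ^ j / ?P"
        using v P by (intro divide_right_mono power_mono) auto
      also have "\<dots> \<le> C * (1 / 2) ^ j"
        using C(2)[of j n] P by (simp add: field_simps)
      finally have "norm v ^ j / ?P \<le> C * (1 / 2) ^ j" .
      moreover have "norm z ^ n \<le> \<rho> ^ n" using z by (intro power_mono) auto
      ultimately have "(norm v ^ j / ?P) * (norm (fps_nth c n) * norm z ^ n)
          \<le> C * (1 / 2) ^ j * (norm (fps_nth c n) * \<rho> ^ n)"
        using C(1) by (intro mult_mono mult_left_mono) auto
      moreover have "norm (v ^ j * (fps_nth ?p n * z ^ n))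
          = (norm v ^ j / ?P) * (norm (fps_nth c n) * norm z ^ n)"
        by (simp only: divided_fps_def fps_nth_Abs_fps lessThan_Suc_atMost norm_mult norm_divide
            norm_power prod_norm[symmetric]) simp
      ultimately show ?thesis by simp
    qed
    have "norm z < fps_conv_radius ?p"
      using z \<rho>(2) divided_fps_conv_radius[OF assms(1,2), of c "Suc j"]
      by (meson ereal_less_eq(3) le_less_trans less_le_trans)
    then have "(\<lambda>n. v ^ j * (fps_nth ?p n * z ^ n)) sums (v ^ j * eval_fps ?p z)"
      by (intro sums_mult sums_eval_fps)
    then have "norm (v ^ j * eval_fps ?p z)
        = norm (\<Sum>n. v ^ j * (fps_nth ?p n * z ^ n))"
      by (simp add: sums_iff)
    also have "\<dots> \<le> (\<Sum>n. C * (1 / 2) ^ j * (norm (fps_nth c n) * \<rho> ^ n))"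
      using coeff sum by (intro norm_suminf_le summable_mult) auto
    also have "\<dots> = (C * (\<Sum>n. norm (fps_nth c n) * \<rho> ^ n)) * (1 / 2) ^ j"
      using sum by (subst suminf_mult) (auto simp: mult_ac)
    finally show "norm (v ^ j * eval_fps ?p z)
        \<le> (C * (\<Sum>n. norm (fps_nth c n) * \<rho> ^ n)) * (1 / 2) ^ j" .
  qed
qed

text \<open>On a compact set \<open>norm z\<close> attains its maximum, which therefore lies strictly inside the disc of convergence.\<close>

lemma divided_series_uniformly_convergent_on_compact:
  assumes "\<gamma> \<noteq> 0" and nz: "\<And>m n. linear_divisor \<alpha> \<beta> \<gamma> m n \<noteq> 0"
    and small: "\<not> small_divisors \<alpha> \<beta> \<gamma>"
    and K: "compact K" and v: "continuous_on K v" and z: "continuous_on K z"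
    and v0: "\<And>x. x \<in> K \<Longrightarrow> \<beta> = 0 \<Longrightarrow> v x = 0"
    and radius: "\<And>x. x \<in> K \<Longrightarrow> norm (z x) < fps_conv_radius c"
  shows "uniformly_convergent_on K
     (\<lambda>J x. \<Sum>j<J. v x ^ j * eval_fps (divided_fps c \<alpha> \<beta> \<gamma> (Suc j)) (z x))"
proof (cases "K = {}")
  case True
  then show ?thesis by (simp add: uniformly_convergent_on_def uniform_limit_iff)
next
  case False
  obtain xv where xv: "xv \<in> K" "\<And>x. x \<in> K \<Longrightarrow> norm (v x) \<le> norm (v xv)"
    using continuous_attains_sup[OF K False continuous_on_norm[OF v]] by blast
  obtain xz where xz: "xz \<in> K" "\<And>x. x \<in> K \<Longrightarrow> norm (z x) \<le> norm (z xz)"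
    using continuous_attains_sup[OF K False continuous_on_norm[OF z]] by blast
  obtain M where M: "\<And>j w y. norm w \<le> norm (v xv) \<Longrightarrow> norm y \<le> norm (z xz) \<Longrightarrow>
      norm (w ^ j * eval_fps (divided_fps c \<alpha> \<beta> \<gamma> (Suc j)) y) \<le> M * (1 / 2) ^ j"
    by (rule divided_fps_terms_bound[OF assms(1-3), of "norm (v xv)" "norm (z xz)" c])
       (use radius xz(1) xv(1) v0 in auto)
  show ?thesis
  proof (rule Weierstrass_m_test')
    show "summable (\<lambda>j. M * (1 / 2 :: real) ^ j)"
      by (intro summable_mult summable_geometric) simp
  qed (use M xv(2) xz(2) in auto)
qed

section \<open>The hypergeometric functions as divided power series\<close>

lemma foldl_mult_eq_prod_list:
  fixes x :: "'a::comm_monoid_mult"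
  shows "foldl (\<lambda>r a. r * f a) x xs = x * (\<Prod>a\<leftarrow>xs. f a)"
  by (induction xs arbitrary: x) (simp_all add: mult_ac)

text \<open>Both sides come from the two ways of splitting a factor off \<open>pochhammer A (Suc n)\<close>. The lower parameters
of \<open>F\<^sub>N\<close> that are added to \<open>bs\<close> exceed the upper ones by exactly 1, so each added pair contributes a
single linear divisor.\<close>

lemma pochhammer_ratio_shift:
  fixes A :: "'a::field_char_0"
  assumes "A + 1 \<notin> \<int>\<^sub>\<le>\<^sub>0" and "A + of_nat n \<noteq> 0"
  shows "pochhammer A n / pochhammer (A + 1) n = A / (A + of_nat n)"
proof -
  have "pochhammer (A + 1) n \<noteq> 0"
    using assms(1) by (auto simp: pochhammer_eq_0_iff)
  moreover have "(A + of_nat n) * pochhammer A n = A * pochhammer (A + 1) n"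
    using pochhammer_rec[of A n] pochhammer_rec'[of A n] by simp
  ultimately show ?thesis using assms(2) by (simp add: field_simps)
qed

lemma fps_hypergeo_F:
  assumes "\<gamma> \<noteq> 0" and nz: "\<And>m n. linear_divisor \<alpha> \<beta> \<gamma> m n \<noteq> 0"
    and lower: "\<And>m. (\<alpha> + \<gamma> + of_nat m * \<beta> + 1) / \<gamma> \<notin> \<int>\<^sub>\<le>\<^sub>0"
  shows "fps_hypergeo (F_upper as \<alpha> \<beta> \<gamma> N) (F_lower bs \<alpha> \<beta> \<gamma> N) 1 =
     fps_const (\<Prod>m\<le>N. \<alpha> + of_nat m * \<beta> + 1) * divided_fps (fps_hypergeo as bs 1) \<alpha> \<beta> \<gamma> (Suc N)"
proof (rule fps_ext)
  fix n
  define A where "A m = (\<alpha> + of_nat m * \<beta> + 1) / \<gamma>" for m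
  have up: "(\<Prod>a\<leftarrow>F_upper as \<alpha> \<beta> \<gamma> N. pochhammer a n)
      = (\<Prod>a\<leftarrow>as. pochhammer a n) * (\<Prod>m\<le>N. pochhammer (A m) n)"
    by (simp add: F_upper_def A_def prod.distinct_set_conv_list[symmetric] comp_def
        atLeast0LessThan lessThan_Suc_atMost flip: upt_Suc)
  have A1: "(\<alpha> + \<gamma> + of_nat m * \<beta> + 1) / \<gamma> = A m + 1" for m
    using \<open>\<gamma> \<noteq> 0\<close> by (simp add: A_def field_simps)
  have lo: "(\<Prod>a\<leftarrow>F_lower bs \<alpha> \<beta> \<gamma> N. pochhammer a n)
      = (\<Prod>a\<leftarrow>bs. pochhammer a n) * (\<Prod>m\<le>N. pochhammer (A m + 1) n)"
    by (simp add: F_lower_def A1 prod.distinct_set_conv_list[symmetric] comp_def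
        atLeast0LessThan lessThan_Suc_atMost flip: upt_Suc)
  have An: "A m + of_nat n = linear_divisor \<alpha> \<beta> \<gamma> m n / \<gamma>" for m
    using \<open>\<gamma> \<noteq> 0\<close> by (simp add: A_def linear_divisor_def field_simps)
  have "pochhammer (A m) n / pochhammer (A m + 1) n
      = (\<alpha> + of_nat m * \<beta> + 1) / linear_divisor \<alpha> \<beta> \<gamma> m n" for m
    using pochhammer_ratio_shift[of "A m" n] lower[of m] nz[of m n] \<open>\<gamma> \<noteq> 0\<close>
    unfolding A1 An by (simp add: A_def)
  then have "(\<Prod>m\<le>N. pochhammer (A m) n) / (\<Prod>m\<le>N. pochhammer (A m + 1) n)
      = (\<Prod>m\<le>N. \<alpha> + of_nat m * \<beta> + 1) / (\<Prod>m\<le>N. linear_divisor \<alpha> \<beta> \<gamma> m n)"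
    by (simp flip: prod_dividef)
  moreover have "fps_nth (fps_hypergeo (F_upper as \<alpha> \<beta> \<gamma> N) (F_lower bs \<alpha> \<beta> \<gamma> N) 1) n
      = fps_nth (fps_hypergeo as bs 1) n
        * ((\<Prod>m\<le>N. pochhammer (A m) n) / (\<Prod>m\<le>N. pochhammer (A m + 1) n))"
    by (simp add: foldl_mult_eq_prod_list up lo)
  ultimately show "fps_nth (fps_hypergeo (F_upper as \<alpha> \<beta> \<gamma> N) (F_lower bs \<alpha> \<beta> \<gamma> N) 1) n
      = fps_nth (fps_const (\<Prod>m\<le>N. \<alpha> + of_nat m * \<beta> + 1)
          * divided_fps (fps_hypergeo as bs 1) \<alpha> \<beta> \<gamma> (Suc N)) n"
    by (simp only: divided_fps_def fps_mult_left_const_nth fps_nth_Abs_fps lessThan_Suc_atMost) simp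
qed

section \<open>Powers and hypergeometric functions along a branch of the logarithm\<close>

lemma bpow_nonzero [simp]: "bpow L x a \<noteq> 0"
  by (simp add: bpow_def)

lemma has_field_derivative_bpow:
  assumes "open S" and L: "L holomorphic_on S" "\<And>x. x \<in> S \<Longrightarrow> exp (L x) = x" and "x \<in> S"
  shows "((\<lambda>x. bpow L x a) has_field_derivative a / x * bpow L x a) (at x)"
  unfolding bpow_def times_divide_eq_left times_divide_eq_right
  by (rule derivative_eq_intros refl has_field_derivative_complex_logarithm[OF L(2,1) \<open>x \<in> S\<close> \<open>open S\<close>])+ (simp_all add: divide_inverse mult_ac)

lemma continuous_on_bpow:
  assumes "L holomorphic_on S"
  shows "continuous_on S (\<lambda>x. bpow L x a)"
  unfolding bpow_def using holomorphic_on_imp_continuous_on[OF assms] by (intro continuous_intros)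

lemma bpow_add_one:
  assumes "exp (L x) = x"
  shows "bpow L x (a + 1) = x * bpow L x a"
  using assms by (simp add: bpow_def exp_add distrib_right)

text \<open>Convergence is assumed at every point of the open set \<open>S\<close>, possibly only conditionally. The argument
\<open>lam * x ^ \<gamma>\<close> is not constant, so by the maximum modulus principle its norm is exceeded at some
other point of \<open>S\<close>, and no argument lies on the circle of convergence.\<close>

lemma hypergeom_argument_inside_conv_radius:
  assumes "\<gamma> \<noteq> 0" and "lam \<noteq> 0" and S: "open S" "connected S"
    and L: "L holomorphic_on S" "\<And>x. x \<in> S \<Longrightarrow> exp (L x) = x"
    and conv: "\<And>x. x \<in> S \<Longrightarrow> hypergeom_converges as bs (lam * bpow L x \<gamma>)"
    and x: "x \<in> S"
  shows "norm (lam * bpow L x \<gamma>) < fps_conv_radius (fps_hypergeo as bs 1)"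
proof -
  define z where "z = (\<lambda>x. lam * bpow L x \<gamma>)"
  have dz: "(z has_field_derivative \<gamma> / y * z y) (at y)" if "y \<in> S" for y
    unfolding z_def
    by (rule derivative_eq_intros refl has_field_derivative_bpow[OF S(1) L that])+ simp_all
  have x0: "x \<noteq> 0" using L(2)[OF x] by (metis exp_not_eq_zero)
  have "\<not> z constant_on S"
  proof
    assume "z constant_on S"
    then obtain k where k: "\<And>y. y \<in> S \<Longrightarrow> z y = k" unfolding constant_on_def by blast
    have "(z has_field_derivative 0) (at x)"
      using has_field_derivative_transform_within_open[OF DERIV_const S(1) x] k by metis
    then have "\<gamma> / x * z x = 0" using DERIV_unique[OF dz[OF x]] by simp
    then show False using assms(1,2) x0 by (simp add: z_def)
  qed
  moreover have "z holomorphic_on S"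
    using dz S(1) holomorphic_on_open by blast
  ultimately obtain y where y: "y \<in> S" "norm (z x) < norm (z y)"
    using maximum_modulus_principle[of z S S x] S x by (meson not_le order_refl)
  have "norm (z y) \<le> fps_conv_radius (fps_hypergeo as bs 1)"
    using conv[OF y(1)] unfolding hypergeom_converges_def fps_conv_radius_def z_def
    by (rule conv_radius_geI)
  then show ?thesis using y(2) unfolding z_def by (meson ereal_less_eq(3) less_ereal.simps(1) less_le_trans)
qed

text \<open>For \<open>lam = 0\<close> the series are evaluated at 0 only and may have radius of convergence 0. They are then
replaced by the constant series \<open>c = 1\<close>, which has the same value there.\<close>

lemma hypergeom_F_as_divided_fps:
  assumes "\<gamma> \<noteq> 0" and nz: "\<And>m n. linear_divisor \<alpha> \<beta> \<gamma> m n \<noteq> 0"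
    and lower: "\<And>m. (\<alpha> + \<gamma> + of_nat m * \<beta> + 1) / \<gamma> \<notin> \<int>\<^sub>\<le>\<^sub>0"
    and S: "open S" "connected S"
    and L: "L holomorphic_on S" "\<And>x. x \<in> S \<Longrightarrow> exp (L x) = x"
    and conv: "\<And>x. x \<in> S \<Longrightarrow> hypergeom_converges as bs (lam * bpow L x \<gamma>)"
  obtains c where
    "\<And>x. x \<in> S \<Longrightarrow> norm (lam * bpow L x \<gamma>) < fps_conv_radius c"
    "\<And>x. x \<in> S \<Longrightarrow> hypergeom as bs (lam * bpow L x \<gamma>) = eval_fps c (lam * bpow L x \<gamma>)"
    "\<And>x N. x \<in> S \<Longrightarrow> hypergeom_converges (F_upper as \<alpha> \<beta> \<gamma> N) (F_lower bs \<alpha> \<beta> \<gamma> N) (lam * bpow L x \<gamma>)"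
    "\<And>x N. x \<in> S \<Longrightarrow> F_fun L as bs \<alpha> \<beta> \<gamma> lam N x
       = (\<Prod>m\<le>N. \<alpha> + of_nat m * \<beta> + 1) * eval_fps (divided_fps c \<alpha> \<beta> \<gamma> (Suc N)) (lam * bpow L x \<gamma>)"
proof (cases "lam = 0")
  case True
  show thesis
  proof (rule that[of 1])
    show "hypergeom_converges (F_upper as \<alpha> \<beta> \<gamma> N) (F_lower bs \<alpha> \<beta> \<gamma> N) (lam * bpow L x \<gamma>)" for x N
      unfolding hypergeom_converges_def using True
      by (intro summable_finite[of "{0}"]) auto
    show "F_fun L as bs \<alpha> \<beta> \<gamma> lam N x = (\<Prod>m\<le>N. \<alpha> + of_nat m * \<beta> + 1)
        * eval_fps (divided_fps 1 \<alpha> \<beta> \<gamma> (Suc N)) (lam * bpow L x \<gamma>)" for x N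
      unfolding F_fun_def hypergeom_def fps_hypergeo_F[OF assms(1-3)] using True
      by (simp only: mult_zero_left eval_fps_at_0 fps_mult_left_const_nth divided_fps_def
          fps_nth_Abs_fps fps_hypergeo_0 fps_one_nth) simp
  qed (use True in \<open>simp_all add: hypergeom_def eval_fps_at_0 del: fps_hypergeo_nth\<close>)
next
  case False
  let ?c = "fps_hypergeo as bs 1"
  have radius: "norm (lam * bpow L x \<gamma>) < fps_conv_radius ?c" if "x \<in> S" for x
    using hypergeom_argument_inside_conv_radius[OF assms(1) False S L conv that] .
  have radius': "norm (lam * bpow L x \<gamma>) < fps_conv_radius (divided_fps ?c \<alpha> \<beta> \<gamma> (Suc N))"
    if "x \<in> S" for x N
    using radius[OF that] divided_fps_conv_radius[OF assms(1,2)] by (rule less_le_trans)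
  show thesis
  proof (rule that[of ?c])
    fix x N assume x: "x \<in> S"
    have "norm (lam * bpow L x \<gamma>) < fps_conv_radius
        (fps_const (\<Prod>m\<le>N. \<alpha> + of_nat m * \<beta> + 1) * divided_fps ?c \<alpha> \<beta> \<gamma> (Suc N))"
      using radius'[OF x] by (intro less_le_trans[OF _ fps_conv_radius_mult]) simp
    then show "hypergeom_converges (F_upper as \<alpha> \<beta> \<gamma> N) (F_lower bs \<alpha> \<beta> \<gamma> N) (lam * bpow L x \<gamma>)"
      unfolding hypergeom_converges_def fps_hypergeo_F[OF assms(1-3)] by (rule summable_fps)
    show "F_fun L as bs \<alpha> \<beta> \<gamma> lam N x = (\<Prod>m\<le>N. \<alpha> + of_nat m * \<beta> + 1)
        * eval_fps (divided_fps ?c \<alpha> \<beta> \<gamma> (Suc N)) (lam * bpow L x \<gamma>)"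
      unfolding F_fun_def hypergeom_def fps_hypergeo_F[OF assms(1-3)]
      using radius'[OF x] by (subst eval_fps_mult) simp_all
  qed (use radius in \<open>simp_all add: hypergeom_def\<close>)
qed

section \<open>The derivative of the series\<close>

text \<open>By the differential equation, \<open>x * d/dx\<close> maps the \<open>j\<close>-th term \<open>v ^ j * p (j + 1)\<close> to
\<open>v ^ j * p j - (\<alpha> + 1) * v ^ j * p (j + 1)\<close>. The sum of \<open>v ^ j * p j\<close> is, up to its first and last
terms, \<open>v\<close> times the partial sum itself.\<close>

lemma divided_series_partial_sum_derivative:
  assumes "\<gamma> \<noteq> 0" and nz: "\<And>m n. linear_divisor \<alpha> \<beta> \<gamma> m n \<noteq> 0"
    and v: "(v has_field_derivative \<beta> / x * v x) (at x)"
    and z: "(z has_field_derivative \<gamma> / x * z x) (at x)"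
    and radius: "norm (z x) < fps_conv_radius c" and "x \<noteq> 0"
  defines "p \<equiv> divided_fps c \<alpha> \<beta> \<gamma>"
  defines "s \<equiv> \<lambda>J x. \<Sum>j<J. v x ^ j * eval_fps (p (Suc j)) (z x)"
  shows "(s J has_field_derivative
      (eval_fps c (z x) - v x ^ J * eval_fps (p J) (z x) + (v x - (\<alpha> + 1)) * s J x) / x) (at x)"
proof (induction J)
  case 0
  then show ?case by (simp add: s_def p_def)
next
  case (Suc J)
  have p: "norm (z x) < fps_conv_radius (p (Suc J))"
    unfolding p_def using radius divided_fps_conv_radius[OF assms(1,2), of c "Suc J"] by (rule less_le_trans)
  have "((\<lambda>x. eval_fps (p (Suc J)) (z x)) has_field_derivative
      eval_fps (fps_deriv (p (Suc J))) (z x) * (\<gamma> / x * z x)) (at x)"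
    by (rule DERIV_chain2[OF has_field_derivative_eval_fps[OF p] z])
  also have "eval_fps (fps_deriv (p (Suc J))) (z x) * (\<gamma> / x * z x)
      = (\<gamma> * z x * eval_fps (fps_deriv (p (Suc J))) (z x)) / x"
    by simp
  also have "\<dots> = (eval_fps (p J) (z x) - (\<alpha> + 1 + of_nat J * \<beta>) * eval_fps (p (Suc J)) (z x)) / x"
    unfolding p_def by (simp only: eval_divided_fps_ode[OF assms(1,2) radius])
  finally have dp: "((\<lambda>x. eval_fps (p (Suc J)) (z x)) has_field_derivative
      (eval_fps (p J) (z x) - (\<alpha> + 1 + of_nat J * \<beta>) * eval_fps (p (Suc J)) (z x)) / x) (at x)" .
  have dv: "((\<lambda>x. v x ^ J) has_field_derivative of_nat J * \<beta> / x * v x ^ J) (at x)"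
    using DERIV_power[OF v, of J] by (cases J) (simp_all add: mult_ac)
  have s_Suc: "s (Suc J) = (\<lambda>x. s J x + v x ^ J * eval_fps (p (Suc J)) (z x))"
    by (simp add: s_def fun_eq_iff)
  show ?case
    unfolding s_Suc
    by (rule derivative_eq_intros refl Suc dv dp)+ (use \<open>x \<noteq> 0\<close> in \<open>simp add: field_simps\<close>)
qed

text \<open>Locally uniform convergence of holomorphic functions allows differentiation under the limit, and the
remainder \<open>v ^ J * p J\<close> in the derivative of the partial sum is \<open>v\<close> times a term of a convergent
series, so it vanishes in the limit. The limit satisfies a linear first-order equation for which
\<open>x powr (\<alpha> + 1) * exp (\<eta> * x powr \<beta>)\<close> is an integrating factor.\<close>

lemma divided_series_has_derivative:
  assumes "\<gamma> \<noteq> 0" and nz: "\<And>m n. linear_divisor \<alpha> \<beta> \<gamma> m n \<noteq> 0"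
    and S: "open S" "0 \<notin> S"
    and v: "\<And>x. x \<in> S \<Longrightarrow> (v has_field_derivative \<beta> / x * v x) (at x)"
    and z: "\<And>x. x \<in> S \<Longrightarrow> (z has_field_derivative \<gamma> / x * z x) (at x)"
    and radius: "\<And>x. x \<in> S \<Longrightarrow> norm (z x) < fps_conv_radius c"
    and unif: "\<And>K. compact K \<Longrightarrow> K \<subseteq> S \<Longrightarrow> uniformly_convergent_on K
      (\<lambda>J x. \<Sum>j<J. v x ^ j * eval_fps (divided_fps c \<alpha> \<beta> \<gamma> (Suc j)) (z x))"
    and x: "x \<in> S"
  defines "T \<equiv> \<lambda>x. \<Sum>j. v x ^ j * eval_fps (divided_fps c \<alpha> \<beta> \<gamma> (Suc j)) (z x)"
  shows "summable (\<lambda>j. v x ^ j * eval_fps (divided_fps c \<alpha> \<beta> \<gamma> (Suc j)) (z x))"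
    and "(T has_field_derivative (eval_fps c (z x) + (v x - (\<alpha> + 1)) * T x) / x) (at x)"
proof -
  define t where "t = (\<lambda>j x. v x ^ j * eval_fps (divided_fps c \<alpha> \<beta> \<gamma> (Suc j)) (z x))"
  have lim: "uniform_limit K (\<lambda>J x. \<Sum>j<J. t j x) T sequentially" if "compact K" "K \<subseteq> S" for K
  proof -
    have "uniform_limit K (\<lambda>J x. \<Sum>j<J. t j x) (\<lambda>x. lim (\<lambda>J. \<Sum>j<J. t j x)) sequentially"
      using unif[OF that] unfolding t_def uniformly_convergent_uniform_limit_iff .
    then show ?thesis
      unfolding T_def t_def suminf_eq_lim .
  qed
  have summ: "summable (\<lambda>j. t j y)" if "y \<in> S" for y
    using tendsto_uniform_limitI[OF lim[of "{y}"], of y] that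
    by (auto simp: summable_iff_convergent convergent_def)
  then show "summable (\<lambda>j. v x ^ j * eval_fps (divided_fps c \<alpha> \<beta> \<gamma> (Suc j)) (z x))"
    using x by (simp add: t_def)
  define s' where "s' J y = (eval_fps c (z y) - v y ^ J * eval_fps (divided_fps c \<alpha> \<beta> \<gamma> J) (z y)
      + (v y - (\<alpha> + 1)) * (\<Sum>j<J. t j y)) / y" for J y
  have deriv: "((\<lambda>y. \<Sum>j<J. t j y) has_field_derivative s' J y) (at y)" if "y \<in> S" for J y
    unfolding s'_def t_def
    using that S(2) by (intro divided_series_partial_sum_derivative[OF assms(1,2)] v z radius) auto
  obtain T' where T': "\<And>y. y \<in> S \<Longrightarrow> (T has_field_derivative T' y) (at y)"
      "\<And>y. y \<in> S \<Longrightarrow> (\<lambda>J. s' J y) \<longlonglongrightarrow> T' y"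
  proof -
    have "\<exists>d>0. cball y d \<subseteq> S \<and> uniform_limit (cball y d) (\<lambda>J x. \<Sum>j<J. t j x) T sequentially"
      if "y \<in> S" for y
      using S(1) that lim[OF compact_cball] by (meson open_contains_cball)
    then have "\<exists>T'. \<forall>y\<in>S. (T has_field_derivative T' y) (at y) \<and> (\<lambda>J. s' J y) \<longlonglongrightarrow> T' y"
      by (intro has_complex_derivative_uniform_sequence[OF S(1) deriv]) auto
    then show thesis using that by blast
  qed
  have sums: "(\<lambda>J. \<Sum>j<J. t j x) \<longlonglongrightarrow> T x"
    using summable_LIMSEQ[OF summ[OF x]] by (simp add: T_def t_def)
  have "(\<lambda>J. v x * t J x) \<longlonglongrightarrow> v x * 0"
    by (intro tendsto_mult tendsto_const summable_LIMSEQ_zero summ x)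
  then have "(\<lambda>J. v x ^ Suc J * eval_fps (divided_fps c \<alpha> \<beta> \<gamma> (Suc J)) (z x)) \<longlonglongrightarrow> 0"
    by (simp add: t_def mult.assoc)
  then have "(\<lambda>J. v x ^ J * eval_fps (divided_fps c \<alpha> \<beta> \<gamma> J) (z x)) \<longlonglongrightarrow> 0"
    by (rule LIMSEQ_imp_Suc)
  then have "(\<lambda>J. s' J x) \<longlonglongrightarrow> (eval_fps c (z x) - 0 + (v x - (\<alpha> + 1)) * T x) / x"
    unfolding s'_def using sums x S(2) by (intro tendsto_intros) auto
  then have "T' x = (eval_fps c (z x) + (v x - (\<alpha> + 1)) * T x) / x"
    using LIMSEQ_unique[OF T'(2)[OF x]] by simp
  then show "(T has_field_derivative (eval_fps c (z x) + (v x - (\<alpha> + 1)) * T x) / x) (at x)"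
    using T'(1)[OF x] by simp
qed

section \<open>The antiderivative\<close>

lemma antiderivatives_differ_by_constant:
  fixes f H :: "complex \<Rightarrow> complex"
  assumes S: "open S" "connected S"
    and H: "\<And>x. x \<in> S \<Longrightarrow> (H has_field_derivative f x) (at x)"
  shows "(\<forall>x\<in>S. (G has_field_derivative f x) (at x)) \<longleftrightarrow> (\<exists>C. \<forall>x\<in>S. G x = H x + C)"
proof
  assume G: "\<forall>x\<in>S. (G has_field_derivative f x) (at x)"
  have "(\<lambda>x. G x - H x) constant_on S"
  proof (rule has_field_derivative_0_imp_constant_on[OF _ S(2,1)])
    show "((\<lambda>x. G x - H x) has_field_derivative 0) (at x)" if "x \<in> S" for x
      using DERIV_diff[OF bspec[OF G that] H[OF that]] by simp
  qed
  then obtain C where "\<And>x. x \<in> S \<Longrightarrow> G x - H x = C" unfolding constant_on_def by blast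
  then have "\<forall>x\<in>S. G x = H x + C" by (metis diff_add_cancel add.commute)
  then show "\<exists>C. \<forall>x\<in>S. G x = H x + C" ..
next
  assume "\<exists>C. \<forall>x\<in>S. G x = H x + C"
  then obtain C where C: "\<And>x. x \<in> S \<Longrightarrow> G x = H x + C" by blast
  show "\<forall>x\<in>S. (G has_field_derivative f x) (at x)"
  proof
    fix x assume x: "x \<in> S"
    have "((\<lambda>x. H x + C) has_field_derivative f x) (at x)"
      using DERIV_add[OF H[OF x] DERIV_const[of C]] by simp
    then show "(G has_field_derivative f x) (at x)"
      by (rule has_field_derivative_transform_within_open[OF _ S(1) x]) (simp add: C)
  qed
qed

theorem proposition1:
  fixes as bs :: "complex list"
    and \<alpha> \<beta> \<gamma> \<eta> lam :: complex
    and S :: "complex set"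
    and L :: "complex \<Rightarrow> complex"
  assumes "\<gamma> \<noteq> 0"
    and S: "open S" "connected S"
    and L: "L holomorphic_on S" "\<And>x. x \<in> S \<Longrightarrow> exp (L x) = x"
    and conv: "\<And>x. x \<in> S \<Longrightarrow> hypergeom_converges as bs (lam * bpow L x \<gamma>)"
    and denom: "\<And>m. \<alpha> + of_nat m * \<beta> + 1 \<noteq> 0"
    and lower: "\<And>m. (\<alpha> + \<gamma> + of_nat m * \<beta> + 1) / \<gamma> \<notin> \<int>\<^sub>\<le>\<^sub>0"
    and exceptional: "small_divisors \<alpha> \<beta> \<gamma> \<Longrightarrow>
      (\<And>K. compact K \<Longrightarrow> K \<subseteq> S \<Longrightarrow>
        uniformly_convergent_on K
          (\<lambda>J x. \<Sum>j<J. series_term L as bs \<alpha> \<beta> \<gamma> \<eta> lam j x))"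
  shows "(\<forall>x\<in>S. \<forall>N. hypergeom_converges
             (F_upper as \<alpha> \<beta> \<gamma> N) (F_lower bs \<alpha> \<beta> \<gamma> N) (lam * bpow L x \<gamma>)) \<and>
         (\<forall>x\<in>S. summable (\<lambda>j. series_term L as bs \<alpha> \<beta> \<gamma> \<eta> lam j x)) \<and>
         (\<forall>G. (\<forall>x\<in>S. (G has_field_derivative
               bpow L x \<alpha> * exp (\<eta> * bpow L x \<beta>) * hypergeom as bs (lam * bpow L x \<gamma>)) (at x))
           \<longleftrightarrow> (\<exists>C. \<forall>x\<in>S. G x =
               bpow L x (\<alpha> + 1) * exp (\<eta> * bpow L x \<beta>)
                 * (\<Sum>j. series_term L as bs \<alpha> \<beta> \<gamma> \<eta> lam j x) + C))"
proof -
  have nz: "linear_divisor \<alpha> \<beta> \<gamma> m n \<noteq> 0" for m n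
    by (rule linear_divisor_nonzero[OF assms(1) denom lower])
  obtain c where
    radius: "\<And>x. x \<in> S \<Longrightarrow> norm (lam * bpow L x \<gamma>) < fps_conv_radius c" and
    hyp: "\<And>x. x \<in> S \<Longrightarrow> hypergeom as bs (lam * bpow L x \<gamma>) = eval_fps c (lam * bpow L x \<gamma>)" and
    conv_F: "\<And>x N. x \<in> S \<Longrightarrow>
      hypergeom_converges (F_upper as \<alpha> \<beta> \<gamma> N) (F_lower bs \<alpha> \<beta> \<gamma> N) (lam * bpow L x \<gamma>)" and
    F: "\<And>x N. x \<in> S \<Longrightarrow> F_fun L as bs \<alpha> \<beta> \<gamma> lam N x
       = (\<Prod>m\<le>N. \<alpha> + of_nat m * \<beta> + 1) * eval_fps (divided_fps c \<alpha> \<beta> \<gamma> (Suc N)) (lam * bpow L x \<gamma>)"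
    using hypergeom_F_as_divided_fps[OF assms(1) nz lower S L conv] by blast
  define v where "v = (\<lambda>x. - \<beta> * \<eta> * bpow L x \<beta>)"
  define z where "z = (\<lambda>x. lam * bpow L x \<gamma>)"
  have db: "((\<lambda>x. bpow L x a) has_field_derivative a / x * bpow L x a) (at x)" if "x \<in> S" for a x
    using has_field_derivative_bpow[OF S(1) L that] .
  have dv: "(v has_field_derivative \<beta> / x * v x) (at x)" if "x \<in> S" for x
    unfolding v_def by (rule derivative_eq_intros refl db[OF that])+ simp_all
  have dz: "(z has_field_derivative \<gamma> / x * z x) (at x)" if "x \<in> S" for x
    unfolding z_def by (rule derivative_eq_intros refl db[OF that])+ simp_all
  have "0 \<notin> S" using L(2) by (metis exp_not_eq_zero)
  have term_eq: "series_term L as bs \<alpha> \<beta> \<gamma> \<eta> lam j x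
      = v x ^ j * eval_fps (divided_fps c \<alpha> \<beta> \<gamma> (Suc j)) (z x)" if "x \<in> S" for x j
    using denom by (simp add: series_term_def F[OF that] v_def z_def del: prod.atMost_Suc)
  have unif: "uniformly_convergent_on K
      (\<lambda>J x. \<Sum>j<J. v x ^ j * eval_fps (divided_fps c \<alpha> \<beta> \<gamma> (Suc j)) (z x))"
    if K: "compact K" "K \<subseteq> S" for K
  proof (cases "small_divisors \<alpha> \<beta> \<gamma>")
    case True
    from exceptional[OF True K] show ?thesis
      by (rule uniformly_convergent_cong[THEN iffD1, rotated -1])
         (use K(2) in \<open>auto intro!: always_eventually sum.cong simp: term_eq subset_iff\<close>)
  next
    case False
    have "continuous_on K (\<lambda>x. bpow L x a)" for a
      using continuous_on_bpow[OF L(1)] K(2) by (rule continuous_on_subset)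
    then show ?thesis
      using K(2) radius
      by (intro divided_series_uniformly_convergent_on_compact[OF assms(1) nz False K(1)])
         (auto simp: v_def z_def intro!: continuous_intros)
  qed
  have radius_z: "norm (z x) < fps_conv_radius c" if "x \<in> S" for x
    using radius[OF that] by (simp add: z_def)
  have series:
    "summable (\<lambda>j. v x ^ j * eval_fps (divided_fps c \<alpha> \<beta> \<gamma> (Suc j)) (z x))"
    "((\<lambda>x. \<Sum>j. v x ^ j * eval_fps (divided_fps c \<alpha> \<beta> \<gamma> (Suc j)) (z x)) has_field_derivative
      (eval_fps c (z x) + (v x - (\<alpha> + 1))
        * (\<Sum>j. v x ^ j * eval_fps (divided_fps c \<alpha> \<beta> \<gamma> (Suc j)) (z x))) / x) (at x)"
    if "x \<in> S" for x
    by (rule divided_series_has_derivative[OF assms(1) nz S(1) \<open>0 \<notin> S\<close> dv dz radius_z unif that]; assumption)+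
  define T where "T = (\<lambda>x. \<Sum>j. v x ^ j * eval_fps (divided_fps c \<alpha> \<beta> \<gamma> (Suc j)) (z x))"
  define H where "H = (\<lambda>x. bpow L x (\<alpha> + 1) * exp (\<eta> * bpow L x \<beta>) * T x)"
  have dH: "(H has_field_derivative
      bpow L x \<alpha> * exp (\<eta> * bpow L x \<beta>) * hypergeom as bs (lam * bpow L x \<gamma>)) (at x)"
    if x: "x \<in> S" for x
  proof -
    have "x \<noteq> 0" using x \<open>0 \<notin> S\<close> by blast
    have dT: "(T has_field_derivative (eval_fps c (z x) + (v x - (\<alpha> + 1)) * T x) / x) (at x)"
      unfolding T_def by (rule series(2)[OF x])
    show ?thesis
      unfolding H_def
      by (rule derivative_eq_intros refl db[OF x] dT)+
         (simp_all only: hyp[OF x] bpow_add_one[of L x, OF L(2)[OF x]] v_def z_def,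
          use \<open>x \<noteq> 0\<close> in \<open>simp add: field_simps\<close>)
  qed
  have "bpow L x (\<alpha> + 1) * exp (\<eta> * bpow L x \<beta>) * (\<Sum>j. series_term L as bs \<alpha> \<beta> \<gamma> \<eta> lam j x) = H x"
    if "x \<in> S" for x
    by (simp add: H_def T_def term_eq[OF that])
  then show ?thesis
    using conv_F series(1) antiderivatives_differ_by_constant[OF S dH] by (simp add: term_eq)
qed

end
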